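(* There exists a (non-binary) bidding game $\langle G,\varepsilon\rangle$ such that every pure subgame-perfect equilibrium (PSPE) of $\langle G,\varepsilon\rangle$ violates both monotonicity and Pareto-optimality.
   Context: A (two-player, impartial) game structure is $G=\langle S,s_0,T,g,u_1,u_2\rangle$ with a finite set of states $S$, initial state $s_0\in S$, terminals $T\subseteq S$, a move function $g$ assigning to each $s\in S\setminus T$ a nonempty set $g(s)\subseteq S$ of next states available to both players (no directed cycles), and utilities $u_i:T\to\mathbb R$. $G$ is binary if $|g(s)|\le 2$ for all $s\in S\setminus T$. Preferences: $t\succ_i t'$ iff $u_i(t)>u_i(t')$, or $u_i(t)=u_i(t')$ and $u_{-i}(t)>u_{-i}(t')$, where $-i$ is the other player; terminals with the same pair of utilities are regarded as the same outcome; $\succeq_i$ is the weak version. Bidding game $\langle G,\varepsilon\rangle$, $\varepsilon=1/R'$ with $R'$ a positive integer: budgets and bids are in $\mathcal B_\varepsilon=\{0,\varepsilon,\dots,1\}$; a budget partition $(B_1,B_2)$, $B_1+B_2=1$, is identified with $B_1$. At $s\in S\setminus T$ with budgets $(B_1,B_2)$ each player $i$ simultaneously submits a bid $b_i\le B_i$ and a next state $s_i^*\in g(s)$. The higher bidder wins (ties won by player 1), pays her bid to the other player, and the game moves to the winner's selected state with the updated budgets. A strategy profile $\gamma$ specifies bids and next states for all $s\in S\setminus T$ and $B_1\in\mathcal B_\varepsilon$; $\mu_\gamma(B_1)\in T$ is the terminal reached when $\gamma$ is played from $s_0$ with initial budgets $(B_1,1-B_1)$. $\gamma$ is a PSPE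 if for every $(s,B_1)$ each player best-responds to the other (with respect to $\succ_i$ on the terminal reached) in the subgame from $(s,B_1)$. $\gamma$ is monotone if $\mu_\gamma(B_1')\succeq_1\mu_\gamma(B_1)$ whenever $B_1'>B_1$, and likewise for player 2 (her outcome weakly improves in $\succeq_2$ as $B_2$ increases). $\gamma$ is Pareto-optimal if for every $B_1\in\mathcal B_\varepsilon$ there is no $t'\in T$ with $t'\succ_1\mu_\gamma(B_1)$ and $t'\succ_2\mu_\gamma(B_1)$. *)

theory Defs
  imports Complex_Main
begin

datatype player = P1 | P2

fun other :: "player \<Rightarrow> player" where
  "other P1 = P2"
| "other P2 = P1"

text \<open>The values of \<open>moves\<close> on terminals (and outside the state set), and those of \<open>util\<close> on
  non-terminals, are irrelevant.\<close>

record 'a game =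
  states :: "'a set"
  init :: 'a
  terminals :: "'a set"
  moves :: "'a \<Rightarrow> 'a set"
  util :: "player \<Rightarrow> 'a \<Rightarrow> real"

definition game_structure :: "'a game \<Rightarrow> bool" where
  "game_structure G \<longleftrightarrow>
     finite (states G) \<and> init G \<in> states G \<and> terminals G \<subseteq> states G \<and>
     (\<forall>s \<in> states G - terminals G. moves G s \<noteq> {} \<and> moves G s \<subseteq> states G) \<and>
     acyclic {(s, s'). s \<in> states G - terminals G \<and> s' \<in> moves G s}"

definition binary :: "'a game \<Rightarrow> bool" where
  "binary G \<longleftrightarrow> (\<forall>s \<in> states G - terminals G. card (moves G s) \<le> 2)"

definition pref :: "'a game \<Rightarrow> player \<Rightarrow> 'a \<Rightarrow> 'a \<Rightarrow> bool" where
  "pref G i t t' \<longleftrightarrow>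
     util G i t > util G i t' \<or>
     util G i t = util G i t' \<and> util G (other i) t > util G (other i) t'"

text \<open>Terminals with the same pair of utilities are the same outcome, so indifference means
  equality of both utilities.\<close>

definition weak_pref :: "'a game \<Rightarrow> player \<Rightarrow> 'a \<Rightarrow> 'a \<Rightarrow> bool" where
  "weak_pref G i t t' \<longleftrightarrow> pref G i t t' \<or> (\<forall>j. util G j t = util G j t')"

definition grid :: "real \<Rightarrow> real set" where
  "grid \<epsilon> = {x. \<exists>k::nat. x = real k * \<epsilon> \<and> x \<le> 1}"

text \<open>A budget partition is given by the budget of the first player.\<close>

fun budget :: "player \<Rightarrow> real \<Rightarrow> real" where
  "budget P1 B = B"
| "budget P2 B = 1 - B"

text \<open>A strategy maps a state and the first player's budget to a bid and a selected next state.\<close>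

type_synonym 'a strategy = "'a \<Rightarrow> real \<Rightarrow> real \<times> 'a"
type_synonym 'a profile = "player \<Rightarrow> 'a strategy"

definition is_strategy :: "'a game \<Rightarrow> real \<Rightarrow> player \<Rightarrow> 'a strategy \<Rightarrow> bool" where
  "is_strategy G \<epsilon> i \<sigma> \<longleftrightarrow>
     (\<forall>s \<in> states G - terminals G. \<forall>B \<in> grid \<epsilon>.
        fst (\<sigma> s B) \<in> grid \<epsilon> \<and> fst (\<sigma> s B) \<le> budget i B \<and> snd (\<sigma> s B) \<in> moves G s)"

definition is_profile :: "'a game \<Rightarrow> real \<Rightarrow> 'a profile \<Rightarrow> bool" where
  "is_profile G \<epsilon> \<gamma> \<longleftrightarrow> (\<forall>i. is_strategy G \<epsilon> i (\<gamma> i))"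

text \<open>One round of play, on pairs of a state and the first player's budget. Ties are won by
  \<open>P1\<close>, the winner pays her bid to the other player, and terminals are absorbing.\<close>

fun round_step :: "'a game \<Rightarrow> 'a profile \<Rightarrow> 'a \<times> real \<Rightarrow> 'a \<times> real" where
  "round_step G \<gamma> (s, B) =
     (if s \<in> terminals G then (s, B)
      else if fst (\<gamma> P1 s B) \<ge> fst (\<gamma> P2 s B)
        then (snd (\<gamma> P1 s B), B - fst (\<gamma> P1 s B))
        else (snd (\<gamma> P2 s B), B + fst (\<gamma> P2 s B)))"

text \<open>The terminal reached from \<open>(s, B)\<close>. For a profile of a game structure it exists because
  the move graph is finite and acyclic, and is unique because terminals are absorbing.\<close>

definition outcome :: "'a game \<Rightarrow> 'a profile \<Rightarrow> 'a \<Rightarrow> real \<Rightarrow> 'a" where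
  "outcome G \<gamma> s B =
     (THE t. t \<in> terminals G \<and> (\<exists>n. fst ((round_step G \<gamma> ^^ n) (s, B)) = t))"

definition \<mu> :: "'a game \<Rightarrow> 'a profile \<Rightarrow> real \<Rightarrow> 'a" where
  "\<mu> G \<gamma> B = outcome G \<gamma> (init G) B"

definition PSPE :: "'a game \<Rightarrow> real \<Rightarrow> 'a profile \<Rightarrow> bool" where
  "PSPE G \<epsilon> \<gamma> \<longleftrightarrow>
     is_profile G \<epsilon> \<gamma> \<and>
     (\<forall>s \<in> states G. \<forall>B \<in> grid \<epsilon>. \<forall>i \<sigma>. is_strategy G \<epsilon> i \<sigma> \<longrightarrow>
        weak_pref G i (outcome G \<gamma> s B) (outcome G (\<gamma>(i := \<sigma>)) s B))"

text \<open>\<open>budget i B < budget i B'\<close> is \<open>B < B'\<close> for \<open>P1\<close> and \<open>1 - B < 1 - B'\<close> for \<open>P2\<close>.\<close>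

definition monotone_profile :: "'a game \<Rightarrow> real \<Rightarrow> 'a profile \<Rightarrow> bool" where
  "monotone_profile G \<epsilon> \<gamma> \<longleftrightarrow>
     (\<forall>i. \<forall>B \<in> grid \<epsilon>. \<forall>B' \<in> grid \<epsilon>.
        budget i B < budget i B' \<longrightarrow> weak_pref G i (\<mu> G \<gamma> B') (\<mu> G \<gamma> B))"

definition pareto_optimal :: "'a game \<Rightarrow> real \<Rightarrow> 'a profile \<Rightarrow> bool" where
  "pareto_optimal G \<epsilon> \<gamma> \<longleftrightarrow>
     (\<forall>B \<in> grid \<epsilon>. \<not> (\<exists>t' \<in> terminals G. pref G P1 t' (\<mu> G \<gamma> B) \<and> pref G P2 t' (\<mu> G \<gamma> B)))"

end

theory Submission
  imports Defs
begin

text \<open>Let \<open>\<epsilon> = 1/2\<close>. From the root \<open>0\<close> the players move to a terminal \<open>2\<close> or \<open>3\<close> or to the inner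
  state \<open>1\<close>, and from there to \<open>2\<close> or \<open>4\<close>. The utility pairs of \<open>2\<close>, \<open>3\<close>, \<open>4\<close> are \<open>(0, 2)\<close>,
  \<open>(1, 0)\<close>, \<open>(2, 1)\<close>, so \<open>4\<close> is better than \<open>3\<close> for both players. At the root with budgets
  \<open>(1/2, 1/2)\<close>, player 1 cannot bid \<open>0\<close>, since player 2 would then buy \<open>2\<close>; but bidding \<open>1/2\<close> leaves
  her without money, so the inner state would lead to \<open>2\<close> and her best choice is \<open>3\<close>. With the
  whole budget she moves for free and obtains \<open>4\<close>, so player 2 gains from having less money.\<close>

lemma all_player_iff: "(\<forall>i. P i) \<longleftrightarrow> P P1 \<and> P P2"
  by (metis player.exhaust)

lemma outcome_terminal:
  assumes "s \<in> terminals G"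
  shows "outcome G \<gamma> s B = s"
proof -
  have "(round_step G \<gamma> ^^ n) (s, B) = (s, B)" for n
    using assms by (induction n) auto
  then show ?thesis
    unfolding outcome_def using assms by (intro the_equality) auto
qed

text \<open>A run from a non-terminal reaches a terminal only after at least one round, so dropping
  the first round leaves the set of reached terminals unchanged.\<close>

lemma outcome_step:
  assumes "s \<notin> terminals G" and "round_step G \<gamma> (s, B) = (s', B')"
  shows "outcome G \<gamma> s B = outcome G \<gamma> s' B'"
proof -
  have "(t \<in> terminals G \<and> (\<exists>n. fst ((round_step G \<gamma> ^^ n) (s, B)) = t)) \<longleftrightarrow>
        (t \<in> terminals G \<and> (\<exists>n. fst ((round_step G \<gamma> ^^ n) (s', B')) = t))" (is "?l \<longleftrightarrow> ?r") for t
  proof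
    assume ?l
    then obtain n where t: "t \<in> terminals G" and n: "fst ((round_step G \<gamma> ^^ n) (s, B)) = t"
      by blast
    from t n assms(1) have "n \<noteq> 0" by (intro notI) auto
    then obtain m where "n = Suc m" by (cases n) auto
    with n assms(2) have "fst ((round_step G \<gamma> ^^ m) (s', B')) = t"
      by (simp add: funpow_Suc_right del: funpow.simps round_step.simps)
    with t show ?r by blast
  next
    assume ?r
    then obtain n where t: "t \<in> terminals G" and n: "fst ((round_step G \<gamma> ^^ n) (s', B')) = t"
      by blast
    from n assms(2) have "fst ((round_step G \<gamma> ^^ Suc n) (s, B)) = t"
      by (simp add: funpow_Suc_right del: funpow.simps round_step.simps)
    with t show ?l by blast
  qed
  then show ?thesis
    unfolding outcome_def by simp
qed

text \<open>Deviating only at \<open>(s, B)\<close>, with bid \<open>b\<close> and target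
  \<open>t\<close>, wins the round and ends play at once, so \<open>t\<close> is a lower bound for
  player \<open>i\<close>. The tie rule makes \<open>wins\<close> weak for \<open>P1\<close> and
  strict for \<open>P2\<close>.\<close>

lemma PSPE_buy_terminal:
  assumes "PSPE G \<epsilon> \<gamma>" and s: "s \<in> states G" "s \<notin> terminals G" and "B \<in> grid \<epsilon>"
    and bid: "b \<in> grid \<epsilon>" "b \<le> budget i B"
    and t: "t \<in> moves G s" "t \<in> terminals G"
    and wins: "i = P1 \<and> fst (\<gamma> P2 s B) \<le> b \<or> i = P2 \<and> fst (\<gamma> P1 s B) < b"
  shows "weak_pref G i (outcome G \<gamma> s B) t"
proof -
  define \<sigma> where "\<sigma> = (\<gamma> i)(s := (\<gamma> i s)(B := (b, t)))"
  have "is_strategy G \<epsilon> i (\<gamma> i)"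
    using assms(1) by (simp add: PSPE_def is_profile_def)
  then have "is_strategy G \<epsilon> i \<sigma>"
    using bid t by (auto simp: is_strategy_def \<sigma>_def)
  then have "weak_pref G i (outcome G \<gamma> s B) (outcome G (\<gamma>(i := \<sigma>)) s B)"
    using assms(1) s \<open>B \<in> grid \<epsilon>\<close> by (simp add: PSPE_def)
  moreover obtain B' where "round_step G (\<gamma>(i := \<sigma>)) (s, B) = (t, B')"
    using s wins by (auto simp: \<sigma>_def)
  then have "outcome G (\<gamma>(i := \<sigma>)) s B = t"
    using s t by (simp add: outcome_step outcome_terminal del: round_step.simps)
  ultimately show ?thesis by simp
qed

text \<open>Non-terminals get the pair (0, 0), strictly worst for both players, so being weakly
  preferred to a terminal already forces an outcome to be a terminal.\<close>

definition example_game :: "nat game" where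
  "example_game =
     \<lparr>states = {0, 1, 2, 3, 4}, init = 0, terminals = {2, 3, 4},
      moves = (\<lambda>s. if s = 0 then {1, 2, 3} else {2, 4}),
      util = (\<lambda>i s. case i of P1 \<Rightarrow> (if s = 3 then 1 else if s = 4 then 2 else 0)
                            | P2 \<Rightarrow> (if s = 2 then 2 else if s = 4 then 1 else 0))\<rparr>"

lemma example_game_simps [simp]:
  "states example_game = {0, 1, 2, 3, 4}" "init example_game = 0"
  "terminals example_game = {2, 3, 4}"
  "moves example_game s = (if s = 0 then {1, 2, 3} else {2, 4})"
  "util example_game P1 s = (if s = 3 then 1 else if s = 4 then 2 else 0)"
  "util example_game P2 s = (if s = 2 then 2 else if s = 4 then 1 else 0)"
  by (simp_all add: example_game_def)

lemma game_structure_example_game: "game_structure example_game"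
proof -
  \<comment> \<open>Every move leads to a larger number.\<close>
  have "{(s, s'). s \<in> states example_game - terminals example_game \<and> s' \<in> moves example_game s}
        \<subseteq> less_than"
    by (auto split: if_splits)
  then have "acyclic {(s, s'). s \<in> states example_game - terminals example_game \<and>
                               s' \<in> moves example_game s}"
    using wf_acyclic[OF wf_less_than] acyclic_subset by blast
  then show ?thesis by (simp add: game_structure_def)
qed

lemma not_binary_example_game: "\<not> binary example_game"
  by (auto simp: binary_def)

lemma grid_half: "grid (1/2) = {0, 1/2, 1}"
proof
  show "grid (1/2) \<subseteq> {0, 1/2, 1}"
  proof
    fix x :: real assume "x \<in> grid (1/2)"
    then obtain k :: nat where k: "x = real k * (1/2)" "x \<le> 1"
      by (auto simp: grid_def)
    then have "k \<in> {0, 1, 2}" by auto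
    with k show "x \<in> {0, 1/2, 1}" by auto
  qed
  show "{0, 1/2, 1} \<subseteq> grid (1/2)"
    by (auto simp: grid_def intro: exI[of _ 0] exI[of _ 1] exI[of _ 2])
qed

context
  fixes \<gamma> :: "nat profile"
  assumes PSPE: "PSPE example_game (1/2) \<gamma>"
begin

lemma action:
  assumes "s \<in> {0, 1}" and "B \<in> {0, 1/2, 1}"
  shows "fst (\<gamma> i s B) \<in> {0, 1/2, 1}" "fst (\<gamma> i s B) \<le> budget i B"
    "snd (\<gamma> i s B) \<in> moves example_game s"
proof -
  have "is_strategy example_game (1/2) i (\<gamma> i)"
    using PSPE by (simp add: PSPE_def is_profile_def)
  moreover have "s \<in> states example_game - terminals example_game" "B \<in> grid (1/2)"
    using assms by (auto simp: grid_half)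
  ultimately show "fst (\<gamma> i s B) \<in> {0, 1/2, 1}" "fst (\<gamma> i s B) \<le> budget i B"
    "snd (\<gamma> i s B) \<in> moves example_game s"
    unfolding is_strategy_def grid_half[symmetric] by blast+
qed

text \<open>Player 1 can only bid 0, so player 2 can buy \<open>2\<close>, her unique best
  state.\<close>

lemma outcome_inner_poor: "outcome example_game \<gamma> 1 0 = 2"
proof -
  have "fst (\<gamma> P1 1 0) < 1/2"
    using action[of 1 0 P1] by auto
  then have "weak_pref example_game P2 (outcome example_game \<gamma> 1 0) 2"
    by (intro PSPE_buy_terminal[OF PSPE, where b = "1/2"]) (auto simp: grid_half)
  then show ?thesis
    by (auto simp: weak_pref_def pref_def all_player_iff split: if_splits)
qed

lemma \<mu>_rich: "\<mu> example_game \<gamma> 1 = 4"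
proof -
  \<comment> \<open>Zero bids are affordable at every budget. Against a penniless opponent they win
    both rounds by ties, which secures \<open>4\<close>, the unique best state of player 1.\<close>
  define \<sigma> :: "nat strategy" where "\<sigma> = (\<lambda>s B. (0, if s = 0 then 1 else 4))"
  let ?\<gamma> = "\<gamma>(P1 := \<sigma>)"
  have "is_strategy example_game (1/2) P1 \<sigma>"
    by (auto simp: is_strategy_def grid_half \<sigma>_def)
  then have "weak_pref example_game P1 (outcome example_game \<gamma> 0 1)
    (outcome example_game ?\<gamma> 0 1)"
    using PSPE by (auto simp: PSPE_def grid_half)
  moreover have "outcome example_game ?\<gamma> 0 1 = outcome example_game ?\<gamma> 1 1"
    using action(2)[of 0 1 P2] by (intro outcome_step) (auto simp: \<sigma>_def)
  moreover have "outcome example_game ?\<gamma> 1 1 = outcome example_game ?\<gamma> 4 1"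
    using action(2)[of 1 1 P2] by (intro outcome_step) (auto simp: \<sigma>_def)
  ultimately have "weak_pref example_game P1 (outcome example_game \<gamma> 0 1) 4"
    by (simp add: outcome_terminal)
  then show ?thesis
    by (auto simp: \<mu>_def weak_pref_def pref_def all_player_iff split: if_splits)
qed

lemma \<mu>_equal_budgets: "\<mu> example_game \<gamma> (1/2) = 3"
proof -
  let ?x = "outcome example_game \<gamma> 0 (1/2)"
  have "fst (\<gamma> P2 0 (1/2)) \<le> 1/2"
    using action[of 0 "1/2" P2] by auto
  then have "weak_pref example_game P1 ?x 3"
    by (intro PSPE_buy_terminal[OF PSPE, where b = "1/2"]) (auto simp: grid_half)
  then have x: "?x \<in> {3, 4}"
    by (auto simp: weak_pref_def pref_def all_player_iff split: if_splits)
  \<comment> \<open>Against a zero bid, player 2 could buy \<open>2\<close>, which she strictly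
    prefers to both \<open>3\<close> and \<open>4\<close>.\<close>
  have "fst (\<gamma> P1 0 (1/2)) \<noteq> 0"
  proof
    assume "fst (\<gamma> P1 0 (1/2)) = 0"
    then have "weak_pref example_game P2 ?x 2"
      by (intro PSPE_buy_terminal[OF PSPE, where b = "1/2"]) (auto simp: grid_half)
    with x show False
      by (auto simp: weak_pref_def pref_def all_player_iff)
  qed
  then have "fst (\<gamma> P1 0 (1/2)) = 1/2"
    using action[of 0 "1/2" P1] by auto
  \<comment> \<open>The bid 1/2 wins, if need be by the tie rule, and leaves player 1 with
    nothing.\<close>
  with \<open>fst (\<gamma> P2 0 (1/2)) \<le> 1/2\<close>
  have "?x = outcome example_game \<gamma> (snd (\<gamma> P1 0 (1/2))) 0"
    by (intro outcome_step) auto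
  moreover have "snd (\<gamma> P1 0 (1/2)) \<in> {1, 2, 3}"
    using action[of 0 "1/2" P1] by simp
  \<comment> \<open>From the root, \<open>4\<close> lies only behind state \<open>1\<close>, where
    budget 0 yields \<open>2\<close>.\<close>
  ultimately have "?x \<in> {2, 3}"
    using outcome_inner_poor by (auto simp: outcome_terminal)
  with x show ?thesis by (auto simp: \<mu>_def)
qed

end

theorem proposition6:
  "\<exists>(G :: nat game) (R' :: nat) (\<epsilon> :: real).
     game_structure G \<and> \<not> binary G \<and> R' > 0 \<and> \<epsilon> = 1 / real R' \<and>
     (\<forall>\<gamma>. PSPE G \<epsilon> \<gamma> \<longrightarrow> \<not> monotone_profile G \<epsilon> \<gamma> \<and> \<not> pareto_optimal G \<epsilon> \<gamma>)"
proof (intro exI conjI allI impI)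
  show "game_structure example_game" by (rule game_structure_example_game)
  show "\<not> binary example_game" by (rule not_binary_example_game)
  show "(0::nat) < 2" by simp
  show "1/2 = 1 / real 2" by simp
  fix \<gamma> assume PSPE: "PSPE example_game (1/2) \<gamma>"
  note \<mu> = \<mu>_rich[OF PSPE] \<mu>_equal_budgets[OF PSPE]
  show "\<not> monotone_profile example_game (1/2) \<gamma>"
  proof
    assume "monotone_profile example_game (1/2) \<gamma>"
    \<comment> \<open>Player 2 drops from \<open>4\<close> to \<open>3\<close> when her budget grows
      from 0 to 1/2.\<close>
    moreover have "budget P2 1 < budget P2 (1/2)" "1/2 \<in> grid (1/2)" "1 \<in> grid (1/2)"
      by (auto simp: grid_half)
    ultimately have "weak_pref example_game P2 (\<mu> example_game \<gamma> (1/2)) (\<mu> example_game \<gamma> 1)"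
      unfolding monotone_profile_def by blast
    then show False
      by (auto simp: \<mu> weak_pref_def pref_def all_player_iff)
  qed
  have "pref example_game P1 4 3" "pref example_game P2 4 3"
    by (simp_all add: pref_def)
  then show "\<not> pareto_optimal example_game (1/2) \<gamma>"
    unfolding pareto_optimal_def grid_half using \<mu> by (auto intro!: bexI[of _ 4])
qed

end
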